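(* Let $Y=(8,\underbrace{4,\dots,4}_{11},\underbrace{0,\dots,0}_{11})^{B_{23}}\subset\mathbb{R}^{23}$ be the set of vectors obtained from $(8,4^{11},0^{11})$ by permuting coordinates and changing signs of coordinates (this is $(4\sqrt{15}\,v_{2,11})^{B_{23}}$). Define $\Upsilon:\mathbb{R}^{23}\to\mathbb{R}^{24}$ by \[ \Upsilon(x_1,\dots,x_{23}) = \Bigl(\tfrac{x_1}{\sqrt2},\tfrac{x_1}{\sqrt2},\tfrac{x_2-x_3}{\sqrt2},\tfrac{x_2+x_3}{\sqrt2},\dots,\tfrac{x_{22}-x_{23}}{\sqrt2},\tfrac{x_{22}+x_{23}}{\sqrt2}\Bigr). \] Then $\Upsilon(Y)$ is contained in a single shell of the shorter Leech lattice $O_{23}$, i.e. in $\{x\in O_{23}:\|x\|^2=m\}$ for some $m$.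
   Context: $v_{2,11}=15^{-1/2}(2,1^{11},0^{11})\in\mathbb{R}^{23}$ and $B_{23}$ is the group of coordinate permutations and sign changes. Let $G_{24}\subset\{0,1\}^{24}\subset\mathbb{R}^{24}$ be the codewords of the extended binary Golay code (for a fixed coordinate ordering), viewed as real 0/1 vectors, and $\mathbf 1$ the all-ones vector. The Leech lattice is $\Lambda_{24}=\{\tfrac{1}{\sqrt8}(2c+4x): c\in G_{24},\ x\in\mathbb{Z}^{24},\ \sum x_i\equiv0 \pmod 2\}\cup\{\tfrac{1}{\sqrt8}(\mathbf 1+2c+4x): c\in G_{24},\ x\in\mathbb{Z}^{24},\ \sum x_i\equiv0 \pmod 2\}$. Let $v=\tfrac1{\sqrt8}(4,-4,0,\dots,0)\in\Lambda_{24}$ and let $\pi(t)=t-\frac{\langle t,v\rangle}{\|v\|^2}v$ be the orthogonal projection onto $v^\perp$. The shorter Leech lattice is $O_{23}=\{\pi(x): x\in\Lambda_{24},\ \langle x,v\rangle\in2\mathbb{Z}\}\subset v^\perp$. A shell of a lattice is the set of its vectors of a fixed squared norm. *)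

theory Defs
  imports
    "HOL-Analysis.Analysis"
    "HOL-Computational_Algebra.Polynomial"
    "HOL-Library.Z2"
begin

text \<open>
  Coordinates of \<^typ>\<open>real ^ 23\<close> and \<^typ>\<open>real ^ 24\<close> are numbered from 1, as in the library's
  \<^const>\<open>vector\<close>. The last coordinate has index \<open>23 = 0 :: 23\<close>, respectively \<open>24 = 0 :: 24\<close>.
\<close>

definition signed_perms :: "(real ^ 'n \<Rightarrow> real ^ 'n) set" where
  "signed_perms =
     {(\<lambda>x. \<chi> i. s i * x $ p i) | s p. (\<forall>i. s i \<in> {-1, 1}) \<and> bij p}"

definition v_2_11 :: "real ^ 23" where
  "v_2_11 = (1 / sqrt 15) *\<^sub>R vector ([2] @ replicate 11 1 @ replicate 11 0)"

definition Y :: "(real ^ 23) set" where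
  "Y = {g (vector ([8] @ replicate 11 4 @ replicate 11 0)) | g. g \<in> signed_perms}"

definition Upsilon :: "real ^ 23 \<Rightarrow> real ^ 24" where
  "Upsilon x = vector
    [ x$1 / sqrt 2, x$1 / sqrt 2,
      (x$2 - x$3) / sqrt 2, (x$2 + x$3) / sqrt 2,
      (x$4 - x$5) / sqrt 2, (x$4 + x$5) / sqrt 2,
      (x$6 - x$7) / sqrt 2, (x$6 + x$7) / sqrt 2,
      (x$8 - x$9) / sqrt 2, (x$8 + x$9) / sqrt 2,
      (x$10 - x$11) / sqrt 2, (x$10 + x$11) / sqrt 2,
      (x$12 - x$13) / sqrt 2, (x$12 + x$13) / sqrt 2,
      (x$14 - x$15) / sqrt 2, (x$14 + x$15) / sqrt 2,
      (x$16 - x$17) / sqrt 2, (x$16 + x$17) / sqrt 2,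
      (x$18 - x$19) / sqrt 2, (x$18 + x$19) / sqrt 2,
      (x$20 - x$21) / sqrt 2, (x$20 + x$21) / sqrt 2,
      (x$22 - x$23) / sqrt 2, (x$22 + x$23) / sqrt 2 ]"

text \<open>
  The binary Golay code of length 23 is the cyclic code generated by
  \<open>1 + X\<^sup>2 + X\<^sup>4 + X\<^sup>5 + X\<^sup>6 + X\<^sup>1\<^sup>0 + X\<^sup>1\<^sup>1\<close>, a factor of \<open>X\<^sup>2\<^sup>3 - 1\<close> over the field with two
  elements; its words are the coefficient sequences of the multiples of degree less than 23. The
  extended code appends the parity bit, i.e. the sum of the coefficients, which is the value
  at 1. The permutation \<open>\<sigma>\<close> gives the ordering of the 24 coordinates.
\<close>

definition golay_poly :: "bit poly" where
  "golay_poly = Poly [1, 0, 1, 0, 1, 1, 1, 0, 0, 0, 1, 1]"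

definition golay_word :: "bit poly \<Rightarrow> real ^ 24" where
  "golay_word q = vector (map (\<lambda>b. of_bool (b = 1)) (map (coeff q) [0..<23] @ [poly q 1]))"

definition golay :: "(24 \<Rightarrow> 24) \<Rightarrow> (real ^ 24) set" where
  "golay \<sigma> = {(\<chi> i. golay_word q $ \<sigma> i) | q. degree q < 23 \<and> golay_poly dvd q}"

definition real_vec :: "int ^ 'n \<Rightarrow> real ^ 'n" where
  "real_vec x = (\<chi> i. of_int (x $ i))"

text \<open>
  The parameter \<open>e\<close> is the parity of the coordinate sum of \<open>x\<close> in the second coset. In the
  definition of the source it is even, like in the first coset, so \<open>e = 0\<close>. With that choice
  \<open>(1,...,1)/\<surd>8\<close>, of squared norm 3, belongs to the lattice; the usual Leech lattice, of minimal
  squared norm 4, has \<open>e = 1\<close>. Both are covered.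
\<close>

definition leech_lattice :: "(24 \<Rightarrow> 24) \<Rightarrow> int \<Rightarrow> (real ^ 24) set" where
  "leech_lattice \<sigma> e =
     {(1 / sqrt 8) *\<^sub>R (2 *\<^sub>R c + 4 *\<^sub>R real_vec x) | c x.
        c \<in> golay \<sigma> \<and> (\<Sum>i\<in>UNIV. x $ i) mod 2 = 0} \<union>
     {(1 / sqrt 8) *\<^sub>R ((\<chi> i. 1) + 2 *\<^sub>R c + 4 *\<^sub>R real_vec x) | c x.
        c \<in> golay \<sigma> \<and> (\<Sum>i\<in>UNIV. x $ i) mod 2 = e}"

definition leech_v :: "real ^ 24" where
  "leech_v = (1 / sqrt 8) *\<^sub>R vector ([4, -4] @ replicate 22 0)"

definition leech_proj :: "real ^ 24 \<Rightarrow> real ^ 24" where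
  "leech_proj t = t - ((t \<bullet> leech_v) / (norm leech_v)\<^sup>2) *\<^sub>R leech_v"

definition shorter_leech :: "(24 \<Rightarrow> 24) \<Rightarrow> int \<Rightarrow> (real ^ 24) set" where
  "shorter_leech \<sigma> e =
     {leech_proj x | x. x \<in> leech_lattice \<sigma> e \<and> (\<exists>k::int. x \<bullet> leech_v = 2 * of_int k)}"

definition shell :: "'a::real_normed_vector set \<Rightarrow> real \<Rightarrow> 'a set" where
  "shell L m = {x \<in> L. (norm x)\<^sup>2 = m}"

end

theory Submission
  imports Defs
begin

text \<open>
  Every vector of \<open>Y\<close> is 4 times an integer vector \<open>z\<close>. As \<open>4 / \<surd>2 = 8 / \<surd>8\<close>, the vector
  \<open>\<Upsilon>(4z)\<close> is \<open>(1 / \<surd>8) 4x\<close> with all coordinates of \<open>x\<close> even, so it lies in the first coset of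
  the Leech lattice with the zero codeword. Its first two coordinates agree, so it is orthogonal
  to \<open>v\<close> and fixed by \<open>\<pi>\<close>. Finally, \<open>\<Upsilon>\<close> and signed permutations preserve the norm.
\<close>

text \<open>The entries of \<open>xs\<close> are placed at 1, 2, 3, ... in the index ring. Up to
  \<open>CHAR('n)\<close> of these indices are distinct, so no entry overwrites another.\<close>

lemma sum_vector:
  fixes xs :: "'a::ab_group_add list"
  assumes "length xs \<le> CHAR('n)"
  shows "(\<Sum>i\<in>UNIV. (vector xs :: 'a ^ 'n::{finite,comm_ring_1}) $ i) = sum_list xs"
proof -
  \<comment> \<open>The recursion inside \<open>vector\<close>, with the starting index freed for
    the induction: the tail of a list starts one index later. \<open>vector\<close> itself starts at
    1.\<close>
  define F :: "'a list \<Rightarrow> 'n \<Rightarrow> 'n \<Rightarrow> 'a"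
    where "F xs = foldr (\<lambda>x f n. (f (n + 1)) (n := x)) xs (\<lambda>n x. 0)" for xs
  have F_Cons: "F (x # xs) n = (F xs (n + 1)) (n := x)" for x xs n
    by (simp add: F_def)
  have outside: "F xs m i = 0" if "\<And>k. k < length xs \<Longrightarrow> i \<noteq> m + of_nat k" for xs m i
    using that
  proof (induction xs arbitrary: m)
    case Nil
    then show ?case by (simp add: F_def)
  next
    case (Cons x xs)
    have "i \<noteq> m" using Cons.prems[of 0] by simp
    moreover have "i \<noteq> m + 1 + of_nat k" if "k < length xs" for k
      using Cons.prems[of "Suc k"] that by (simp add: add.assoc)
    ultimately show ?case using Cons.IH[of "m + 1"] by (simp add: F_Cons)
  qed
  have "(\<Sum>i\<in>UNIV. F xs n i) = sum_list xs" if "length xs \<le> CHAR('n)" for xs n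
    using that
  proof (induction xs arbitrary: n)
    case Nil
    then show ?case by (simp add: F_def)
  next
    case (Cons x xs)
    \<comment> \<open>The tail never wraps around to the index of the head: that would make
      \<open>CHAR('n)\<close> divide \<open>Suc k\<close>, which is positive and smaller.\<close>
    have "n \<noteq> n + 1 + of_nat k" if "k < length xs" for k
    proof
      assume "n = n + 1 + of_nat k"
      then have "of_nat (Suc k) = (0 :: 'n)"
        by (simp add: add.assoc)
      then have "CHAR('n) dvd Suc k"
        by (simp only: of_nat_eq_0_iff_char_dvd)
      then show False
        using that Cons.prems by (auto dest: dvd_imp_le)
    qed
    then have "F xs (n + 1) n = 0"
      by (rule outside)
    then have "(\<Sum>i\<in>UNIV. F xs (n + 1) i) = (\<Sum>i\<in>UNIV - {n}. F xs (n + 1) i)"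
      by (simp add: sum.remove[of UNIV n])
    moreover have "(\<Sum>i\<in>UNIV - {n}. F (x # xs) n i) = (\<Sum>i\<in>UNIV - {n}. F xs (n + 1) i)"
      by (simp add: F_Cons)
    ultimately have "(\<Sum>i\<in>UNIV. F (x # xs) n i) = x + (\<Sum>i\<in>UNIV. F xs (n + 1) i)"
      by (simp add: sum.remove[of UNIV n] F_Cons)
    then show ?case
      using Cons by simp
  qed
  then show ?thesis
    using assms by (simp add: vector_def F_def)
qed

text \<open>Coordinates that the list does not reach default to 0, hence the condition on
  \<open>f\<close>.\<close>

lemma vector_map_nth:
  assumes "f 0 = 0"
  shows "(vector (map f xs) :: 'b::zero ^ 'n::{one,plus,finite}) $ i = f (vector xs $ i)"
proof -
  have "foldr (\<lambda>x h n. (h (n + 1)) (n := x)) (map f xs) (\<lambda>n x. 0) n i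
      = f (foldr (\<lambda>x h n. (h (n + 1)) (n := x)) xs (\<lambda>n x. 0) n i)" for n :: 'n
    using assms by (induction xs arbitrary: n) auto
  then show ?thesis
    by (simp add: vector_def)
qed

lemma sum_map_vector:
  fixes f :: "'b::zero \<Rightarrow> 'a::ab_group_add"
  assumes "f 0 = 0" and "length xs \<le> CHAR('n)"
  shows "(\<Sum>i\<in>UNIV. f ((vector xs :: 'b ^ 'n::{finite,comm_ring_1}) $ i)) = (\<Sum>x\<leftarrow>xs. f x)"
  using sum_vector[of "map f xs", where 'n = 'n] assms by (simp add: vector_map_nth)

text \<open>Signs square to 1, and the bijection \<open>p\<close> only reorders the sum of
  squares.\<close>

lemma norm_signed_perm:
  fixes x :: "real ^ 'n"
  assumes "g \<in> signed_perms"
  shows "norm (g x) = norm x"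
proof -
  obtain s and p :: "'n \<Rightarrow> 'n" where s: "\<And>i. s i \<in> {-1, 1 :: real}" and p: "bij p"
    and g: "g = (\<lambda>x. \<chi> i. s i * x $ p i)"
    using assms unfolding signed_perms_def by blast
  have "s i * s i = 1" for i
    using s[of i] by auto
  then have "(s i * x $ p i) * (s i * x $ p i) = x $ p i * x $ p i" for i
    by (metis mult.assoc mult.left_commute mult_1)
  then have "g x \<bullet> g x = (\<Sum>i\<in>UNIV. x $ p i * x $ p i)"
    by (simp only: inner_vec_def g vec_lambda_beta inner_real_def)
  also have "\<dots> = x \<bullet> x"
    using sum.reindex_bij_betw[OF p, of "\<lambda>i. x $ i * x $ i"] by (simp add: inner_vec_def)
  finally show ?thesis
    by (simp add: norm_eq_sqrt_inner)
qed

text \<open>The first coordinate is split into two equal parts, each with half its square; every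
  later pair is rotated by 45 degrees.\<close>

lemma norm_Upsilon: "norm (Upsilon x) = norm x"
proof -
  have 23: "(UNIV::23 set) =
    {1,2,3,4,5,6,7,8,9,10,11,12,13,14,15,16,17,18,19,20,21,22,23}"
    by (rule sym, rule card_subset_eq) simp_all
  \<comment> \<open>Here \<open>r\<close> is the rest of the right-nested sum, so that rewriting
    consumes two summands at a time; the last pair is the case \<open>r = 0\<close>.\<close>
  have head: "(a / sqrt 2)\<^sup>2 + ((a / sqrt 2)\<^sup>2 + r) = a\<^sup>2 + r" for a r :: real
    by (simp add: field_simps)
  have pair: "((a - b) / sqrt 2)\<^sup>2 + (((a + b) / sqrt 2)\<^sup>2 + r) = a\<^sup>2 + (b\<^sup>2 + r)"
    for a b r :: real
    by (simp add: power2_eq_square field_simps)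
  have "Upsilon x \<bullet> Upsilon x = (\<Sum>i\<in>UNIV. (Upsilon x $ i)\<^sup>2)"
    by (simp add: inner_vec_def power2_eq_square)
  also have "\<dots> = (\<Sum>i\<in>UNIV. (x $ i)\<^sup>2)"
    unfolding Upsilon_def 23
    by (subst sum_map_vector) (simp_all add: head pair pair[where r = 0, unfolded add_0_right])
  also have "\<dots> = x \<bullet> x"
    by (simp add: inner_vec_def power2_eq_square)
  finally show ?thesis
    by (simp add: norm_eq_sqrt_inner)
qed

lemma Upsilon_inner_leech_v: "Upsilon x \<bullet> leech_v = 0"
proof -
  have v: "leech_v = (4 / sqrt 8) *\<^sub>R (axis 1 1 - axis 2 1)"
    by (simp add: vec_eq_iff leech_v_def vector_def axis_def numeral_eq_Suc)
  have "Upsilon x $ 1 = Upsilon x $ 2"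
    by (simp add: Upsilon_def vector_def)
  then show ?thesis
    unfolding v inner_scaleR_right inner_diff_right inner_axis by simp
qed

text \<open>The zero polynomial is a multiple of the generator, and its word is fixed by every
  reordering of coordinates.\<close>

lemma zero_in_golay: "0 \<in> golay \<sigma>"
proof -
  have "golay_word 0 $ i = 0" for i
    unfolding golay_word_def
    by (subst map_append, subst map_map)
       (simp add: vector_def numeral_eq_Suc upt_rec)
  then show ?thesis
    unfolding golay_def by (intro CollectI exI[of _ 0]) (simp add: vec_eq_iff)
qed

lemma Upsilon_in_leech_lattice: "Upsilon (4 *\<^sub>R real_vec z) \<in> leech_lattice \<sigma> e"
proof -
  \<comment> \<open>The factor 2 comes from \<open>4 / sqrt 2 = 2 * (4 / sqrt 8)\<close>. It makes
    each entry even, and with it the coordinate sum.\<close>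
  define x :: "int ^ 24" where "x = vector (map ((*) 2)
    [ z$1, z$1, z$2 - z$3, z$2 + z$3, z$4 - z$5, z$4 + z$5, z$6 - z$7, z$6 + z$7,
      z$8 - z$9, z$8 + z$9, z$10 - z$11, z$10 + z$11, z$12 - z$13, z$12 + z$13,
      z$14 - z$15, z$14 + z$15, z$16 - z$17, z$16 + z$17, z$18 - z$19, z$18 + z$19,
      z$20 - z$21, z$20 + z$21, z$22 - z$23, z$22 + z$23 ])"
  have "even (x $ i)" for i
    unfolding x_def by (subst vector_map_nth) auto
  then have even: "(\<Sum>i\<in>UNIV. x $ i) mod 2 = 0"
    by (auto intro: dvd_sum simp flip: even_iff_mod_2_eq_zero)
  have sqrt8: "sqrt 8 = 2 * sqrt 2"
    using real_sqrt_mult[of 4 2] by simp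
  \<comment> \<open>The list is the image of the one defining \<open>x\<close>, so
    \<open>vector_map_nth\<close> yields all 24 coordinates at once.\<close>
  have "Upsilon (4 *\<^sub>R real_vec z) = vector (map (\<lambda>m. of_int m * (4 / sqrt 8)) (map ((*) 2)
    [ z$1, z$1, z$2 - z$3, z$2 + z$3, z$4 - z$5, z$4 + z$5, z$6 - z$7, z$6 + z$7,
      z$8 - z$9, z$8 + z$9, z$10 - z$11, z$10 + z$11, z$12 - z$13, z$12 + z$13,
      z$14 - z$15, z$14 + z$15, z$16 - z$17, z$16 + z$17, z$18 - z$19, z$18 + z$19,
      z$20 - z$21, z$20 + z$21, z$22 - z$23, z$22 + z$23 ]))"
    unfolding Upsilon_def by (simp add: real_vec_def sqrt8 field_simps)
  then have "Upsilon (4 *\<^sub>R real_vec z) $ i = of_int (x $ i) * (4 / sqrt 8)" for i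
    unfolding x_def by (subst (asm) vec_eq_iff) (subst (asm) vector_map_nth, simp, blast)
  then have "Upsilon (4 *\<^sub>R real_vec z) = (1 / sqrt 8) *\<^sub>R (2 *\<^sub>R 0 + 4 *\<^sub>R real_vec x)"
    by (simp add: vec_eq_iff real_vec_def)
  with even zero_in_golay show ?thesis
    unfolding leech_lattice_def by (intro UnI1 CollectI exI conjI) auto
qed

lemma Upsilon_in_shorter_leech: "Upsilon (4 *\<^sub>R real_vec z) \<in> shorter_leech \<sigma> e"
proof -
  let ?t = "Upsilon (4 *\<^sub>R real_vec z)"
  have "leech_proj ?t = ?t"
    by (simp add: leech_proj_def Upsilon_inner_leech_v)
  moreover have "?t \<bullet> leech_v = 2 * of_int 0"
    by (simp add: Upsilon_inner_leech_v)
  ultimately show ?thesis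
    unfolding shorter_leech_def by (metis (mono_tags, lifting) Upsilon_in_leech_lattice mem_Collect_eq)
qed

lemma Y_integral:
  assumes "y \<in> Y"
  obtains z where "y = 4 *\<^sub>R real_vec z"
proof -
  \<comment> \<open>One quarter of the vector generating \<open>Y\<close>, over the
    integers.\<close>
  let ?l = "[2] @ replicate 11 1 @ replicate 11 (0::int)"
  obtain s and p :: "23 \<Rightarrow> 23" where s: "\<And>i. s i \<in> {-1, 1 :: real}"
    and y: "y = (\<chi> i. s i * vector ([8] @ replicate 11 4 @ replicate 11 0) $ p i)"
    using assms unfolding Y_def signed_perms_def by blast
  have "[8] @ replicate 11 4 @ replicate 11 0 = map (\<lambda>m. 4 * real_of_int m) ?l"
    by simp
  then have "vector ([8] @ replicate 11 4 @ replicate 11 0) $ i = 4 * real_of_int (vector ?l $ i)"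
    for i :: 23
    by (simp only: vector_map_nth of_int_0 mult_zero_right)
  \<comment> \<open>The floor turns the real sign into an integer one.\<close>
  moreover have "s i = of_int \<lfloor>s i\<rfloor>" for i
    using s[of i] by auto
  ultimately have "y = 4 *\<^sub>R real_vec (\<chi> i. \<lfloor>s i\<rfloor> * vector ?l $ p i)"
    by (simp add: y vec_eq_iff real_vec_def)
  then show ?thesis
    by (rule that)
qed

lemma scaled_v_2_11:
  "(4 * sqrt 15) *\<^sub>R v_2_11 = vector ([8] @ replicate 11 4 @ replicate 11 0)"
proof -
  have "[8] @ replicate 11 4 @ replicate 11 0
      = map ((*) 4) ([2] @ replicate 11 1 @ replicate 11 (0::real))"
    by simp
  then have "vector ([8] @ replicate 11 4 @ replicate 11 0) $ i
      = 4 * (vector ([2] @ replicate 11 1 @ replicate 11 (0::real)) $ i)" for i :: 23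
    by (simp only: vector_map_nth mult_zero_right)
  then show ?thesis
    by (simp add: vec_eq_iff v_2_11_def)
qed

theorem theorem7p5:
  fixes \<sigma> :: "24 \<Rightarrow> 24" and e :: int
  assumes "bij \<sigma>" and "e \<in> {0, 1}"
  shows "Y = {g ((4 * sqrt 15) *\<^sub>R v_2_11) | g. g \<in> signed_perms}
    \<and> (\<exists>m. Upsilon ` Y \<subseteq> shell (shorter_leech \<sigma> e) m)"
proof
  show Y: "Y = {g ((4 * sqrt 15) *\<^sub>R v_2_11) | g. g \<in> signed_perms}"
    by (simp only: Y_def scaled_v_2_11)
  \<comment> \<open>The squared norm of the shell is that of the generating vector,
    \<open>8^2 + 11 * 4^2 = 240\<close>, left unevaluated.\<close>
  have "Upsilon y \<in> shell (shorter_leech \<sigma> e) ((norm ((4 * sqrt 15) *\<^sub>R v_2_11))\<^sup>2)" if "y \<in> Y" for y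
  proof -
    have "norm y = norm ((4 * sqrt 15) *\<^sub>R v_2_11)"
      using that unfolding Y by (force simp only: norm_signed_perm mem_Collect_eq)
    moreover have "Upsilon y \<in> shorter_leech \<sigma> e"
      using that by (metis Y_integral Upsilon_in_shorter_leech)
    ultimately show ?thesis
      by (simp add: shell_def norm_Upsilon)
  qed
  then show "\<exists>m. Upsilon ` Y \<subseteq> shell (shorter_leech \<sigma> e) m"
    by blast
qed

end
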